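(* In the simple game modeling the US legislative system, let $c_p(k)$, $c_v(k)$, $c_s(k)$, $c_r(k)$ denote the number of coalitions of size $k$ in which, respectively, the president, the vice president, a fixed senator, a fixed representative is critical. (a) If $c_p(k)=0$, then $c_v(k)=c_r(k)=c_s(k)=0$. (b) For all $k\in\mathbb{N}$ such that $c_p(k)\ne0$, $c_p(k)>c_v(k)$. (c) For all $k\in\mathbb{N}$ such that $c_p(k)\neq0$, $c_p(k)>c_s(k)$.
   Context: The simple game modeling the US legislative system has 537 players: the president, the vice president, 100 senators and 435 representatives. The "full Senate" is the 101-element set consisting of the 100 senators and the vice president. The minimal winning coalitions are of two types: (I) the president, 51 members of the full Senate, and 218 representatives; (II) 67 senators (the vice president does not count here) and 290 representatives. A coalition (set of players) is winning iff it contains a coalition of type I or II. A player $i$ in a coalition $T$ is critical in $T$ if $T$ is winning and $T\setminus\{i\}$ is not. *)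

theory Defs
  imports Main "HOL-Library.Numeral_Type"
begin

text \<open>
  The numeral types \<open>100\<close> and \<open>435\<close> have exactly 100 and 435 elements; every set of
  players is a coalition.
\<close>

datatype player = President | Vice_President | Senator 100 | Representative 435

definition senators :: "player set" where
  "senators = range Senator"

definition full_senate :: "player set" where
  "full_senate = insert Vice_President senators"

definition representatives :: "player set" where
  "representatives = range Representative"

definition type_I :: "player set \<Rightarrow> bool" where
  "type_I M \<longleftrightarrow> (\<exists>F R. F \<subseteq> full_senate \<and> card F = 51 \<and>
     R \<subseteq> representatives \<and> card R = 218 \<and> M = {President} \<union> F \<union> R)"

definition type_II :: "player set \<Rightarrow> bool" where
  "type_II M \<longleftrightarrow> (\<exists>S R. S \<subseteq> senators \<and> card S = 67 \<and>
     R \<subseteq> representatives \<and> card R = 290 \<and> M = S \<union> R)"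

definition winning :: "player set \<Rightarrow> bool" where
  "winning T \<longleftrightarrow> (\<exists>M \<subseteq> T. type_I M \<or> type_II M)"

definition critical :: "player \<Rightarrow> player set \<Rightarrow> bool" where
  "critical i T \<longleftrightarrow> i \<in> T \<and> winning T \<and> \<not> winning (T - {i})"

definition critical_count :: "player \<Rightarrow> nat \<Rightarrow> nat" where
  "critical_count i k = card {T. card T = k \<and> critical i T}"

abbreviation c_p :: "nat \<Rightarrow> nat" where
  "c_p \<equiv> critical_count President"

abbreviation c_v :: "nat \<Rightarrow> nat" where
  "c_v \<equiv> critical_count Vice_President"

abbreviation c_s :: "100 \<Rightarrow> nat \<Rightarrow> nat" where
  "c_s s \<equiv> critical_count (Senator s)"

abbreviation c_r :: "435 \<Rightarrow> nat \<Rightarrow> nat" where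
  "c_r r \<equiv> critical_count (Representative r)"

lemma UNIV_player:
  "(UNIV :: player set) = {President} \<union> full_senate \<union> representatives"
proof -
  have "x \<in> {President} \<union> full_senate \<union> representatives" for x
    by (cases x) (auto simp: full_senate_def senators_def representatives_def)
  then show ?thesis by blast
qed

lemma card_senators: "card senators = 100"
  unfolding senators_def by (subst card_image) (auto intro: injI)

lemma card_full_senate: "card full_senate = 101"
  unfolding full_senate_def using card_senators
  by (subst card_insert_disjoint) (auto simp: senators_def)

lemma card_representatives: "card representatives = 435"
  unfolding representatives_def by (subst card_image) (auto intro: injI)

instance player :: finite
proof
  show "finite (UNIV :: player set)"
    by (simp add: UNIV_player full_senate_def senators_def representatives_def)
qed

lemma card_player: "card (UNIV :: player set) = 537"
proof -
  have "President \<notin> full_senate \<union> representatives" "full_senate \<inter> representatives = {}"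
    by (auto simp: full_senate_def senators_def representatives_def)
  then show ?thesis
    by (simp add: UNIV_player card_Un_disjoint card_full_senate card_representatives)
qed

end

theory Submission
  imports Defs
begin

text \<open>
  For a player \<open>i\<close>, send a coalition \<open>T\<close> in which \<open>i\<close> is critical to \<open>T\<close> itself if the president
  belongs to \<open>T\<close>, and otherwise to the coalition in which the president replaces \<open>i\<close>. Since a
  coalition satisfying the override condition (II) has members to spare for (I), the president is
  critical in the image, so this size-preserving map gives \<open>c\<^sub>i \<le> c\<^sub>p\<close>; it is injective because
  membership of \<open>i\<close> in the image tells which case applied. If \<open>i\<close> belongs to the full Senate, the
  map is never onto unless \<open>c\<^sub>p = 0\<close>: exchanging \<open>i\<close> for another member of the full Senate moves
  any coalition in its image to one outside of it where the president is still critical.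
\<close>

lemma player_mem_simps [simp]:
  "President \<notin> senators" "President \<notin> full_senate" "President \<notin> representatives"
  "Vice_President \<in> full_senate" "Senator s \<in> full_senate"
  by (auto simp: full_senate_def senators_def representatives_def)

lemma senators_subset_full_senate: "senators \<subseteq> full_senate"
  by (auto simp: full_senate_def)

lemma full_senate_Int_representatives: "full_senate \<inter> representatives = {}"
  by (auto simp: full_senate_def senators_def representatives_def)

text \<open>Any set meeting the quotas contains a minimal coalition, by choosing subsets of exact
  size. Criticality thereby becomes arithmetic on intersection cardinalities.\<close>

lemma winning_iff:
  "winning T \<longleftrightarrow>
     (President \<in> T \<and> 51 \<le> card (T \<inter> full_senate) \<and> 218 \<le> card (T \<inter> representatives)) \<or>
     (67 \<le> card (T \<inter> senators) \<and> 290 \<le> card (T \<inter> representatives))"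
  (is "_ \<longleftrightarrow> ?I \<or> ?II")
proof
  assume "winning T"
  then obtain M where "M \<subseteq> T" and M: "type_I M \<or> type_II M"
    by (auto simp: winning_def)
  from M show "?I \<or> ?II"
  proof
    assume "type_I M"
    then obtain F R where FR: "F \<subseteq> full_senate" "card F = 51" "R \<subseteq> representatives" "card R = 218"
      "M = {President} \<union> F \<union> R"
      by (auto simp: type_I_def)
    moreover have "F \<subseteq> T \<inter> full_senate" "R \<subseteq> T \<inter> representatives" "President \<in> T"
      using FR \<open>M \<subseteq> T\<close> by auto
    ultimately have ?I
      by (metis card_mono finite)
    then show ?thesis ..
  next
    assume "type_II M"
    then obtain S R where SR: "S \<subseteq> senators" "card S = 67" "R \<subseteq> representatives" "card R = 290"
      "M = S \<union> R"
      by (auto simp: type_II_def)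
    moreover have "S \<subseteq> T \<inter> senators" "R \<subseteq> T \<inter> representatives"
      using SR \<open>M \<subseteq> T\<close> by auto
    ultimately have ?II
      by (metis card_mono finite)
    then show ?thesis ..
  qed
next
  assume "?I \<or> ?II"
  then show "winning T"
  proof
    assume I: ?I
    obtain F R where "F \<subseteq> T \<inter> full_senate" "card F = 51" "R \<subseteq> T \<inter> representatives" "card R = 218"
      using I by (meson obtain_subset_with_card_n)
    then have "type_I ({President} \<union> F \<union> R)" "{President} \<union> F \<union> R \<subseteq> T"
      using I unfolding type_I_def by blast+
    then show ?thesis
      unfolding winning_def by blast
  next
    assume II: ?II
    obtain S R where "S \<subseteq> T \<inter> senators" "card S = 67" "R \<subseteq> T \<inter> representatives" "card R = 290"
      using II by (meson obtain_subset_with_card_n)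
    then have "type_II (S \<union> R)" "S \<union> R \<subseteq> T"
      unfolding type_II_def by blast+
    then show ?thesis
      unfolding winning_def by blast
  qed
qed

lemma card_remove_Int:
  fixes T :: "'a::finite set"
  shows "card ((T - {i}) \<inter> A) = (if i \<in> T \<inter> A then card (T \<inter> A) - 1 else card (T \<inter> A))"
proof -
  have "(T - {i}) \<inter> A = T \<inter> A - {i}" by blast
  then show ?thesis by (simp add: card_Diff_singleton_if)
qed

lemma card_insert_Int:
  fixes T :: "'a::finite set"
  shows "card (insert i T \<inter> A) = (if i \<in> A \<and> i \<notin> T then Suc (card (T \<inter> A)) else card (T \<inter> A))"
  by (simp add: Int_insert_left insert_absorb)

lemma card_Int_senators_le: "card (T \<inter> senators) \<le> card (T \<inter> full_senate)"
  by (intro card_mono) (use senators_subset_full_senate in auto)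

text \<open>If \<open>T\<close> met (II), removing a player other than the president would leave at
  least 66 senators and 289 representatives, hence a win by (I). So \<open>T\<close> wins by (I)
  only.\<close>

lemma critical_imp_president_critical:
  assumes "critical i T" "President \<in> T"
  shows "critical President T"
  using assms card_Int_senators_le[of T]
  by (auto simp: critical_def winning_iff card_remove_Int split: if_splits)

text \<open>Without the president \<open>T\<close> wins by (II), and losing \<open>i\<close> costs
  at most one member of each chamber, so adding the president secures (I). Removing the president
  again gives \<open>T - {i}\<close>, which loses.\<close>

lemma critical_imp_president_critical_replaced:
  assumes "critical i T" "President \<notin> T"
  shows "critical President (insert President (T - {i}))"
proof -
  have "insert President (T - {i}) - {President} = T - {i}"
    using assms(2) by auto
  then show ?thesis
    using assms card_Int_senators_le[of T]
    by (auto simp: critical_def winning_iff card_remove_Int card_insert_Int split: if_splits)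
qed

definition to_president :: "player \<Rightarrow> player set \<Rightarrow> player set" where
  "to_president i T = (if President \<in> T then T else insert President (T - {i}))"

lemma critical_to_president: "critical i T \<Longrightarrow> critical President (to_president i T)"
  by (simp add: to_president_def critical_imp_president_critical
      critical_imp_president_critical_replaced)

lemma card_exchange:
  fixes T :: "'a::finite set"
  shows "i \<in> T \<Longrightarrow> j \<notin> T \<Longrightarrow> card (insert j (T - {i})) = card T"
  by (metis Diff_iff card_Suc_Diff1 card_insert_disjoint finite)

lemma card_to_president: "i \<in> T \<Longrightarrow> card (to_president i T) = card T"
  by (metis to_president_def card_exchange)

lemma inj_on_to_president: "inj_on (to_president i) {T. i \<in> T}"
  by (rule inj_on_inverseI[where g = "\<lambda>U. if i \<in> U then U else insert i (U - {President})"])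
    (auto simp: to_president_def)

lemma inj_on_to_president_critical:
  "inj_on (to_president i) {T. card T = k \<and> critical i T}"
  by (rule inj_on_subset[OF inj_on_to_president]) (auto simp: critical_def)

lemma to_president_image_subset:
  "to_president i ` {T. card T = k \<and> critical i T} \<subseteq> {T. card T = k \<and> critical President T}"
  by (auto simp: critical_to_president card_to_president critical_def[of i])

lemma critical_count_le_president: "critical_count i k \<le> critical_count President k"
  unfolding critical_count_def
  by (rule card_inj_on_le[OF inj_on_to_president_critical to_president_image_subset]) simp

text \<open>\<open>T\<close> itself serves unless it has a preimage. Whether that preimage contains
  the president decides if \<open>i\<close> is swapped out of \<open>T\<close> or into it.\<close>

lemma exists_outside_image:
  assumes i: "i \<in> full_senate" and T: "critical President T"
  shows "\<exists>U. card U = card T \<and> critical President U \<and> U \<notin> to_president i ` {U. critical i U}"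
proof (cases "T \<in> to_president i ` {U. critical i U}")
  case False
  with T show ?thesis by blast
next
  case True
  then obtain U where U: "critical i U" "T = to_president i U" by blast
  have iP: "i \<noteq> President" "i \<notin> representatives"
    using i full_senate_Int_representatives by auto
  show ?thesis
  proof (cases "President \<in> U")
    case True
    then have crit: "critical i T"
      using U by (simp add: to_president_def)
    have mem: "President \<in> T" "i \<in> T"
      using T crit by (auto simp: critical_def)
    \<comment> \<open>Removing \<open>i\<close> keeps the president and all representatives, so it
      can only break the Senate quota of (I), which must be tight.\<close>
    have F: "card (T \<inter> full_senate) = 51" and R: "218 \<le> card (T \<inter> representatives)"
      using crit mem i iP card_Int_senators_le[of T] T
      by (auto simp: critical_def winning_iff card_remove_Int split: if_splits)
    have "\<not> full_senate \<subseteq> T"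
      using F card_full_senate by (auto simp: Int_absorb1)
    then obtain j where j: "j \<in> full_senate" "j \<notin> T" by blast
    have jP: "j \<noteq> President" "j \<notin> representatives" "j \<noteq> i"
      using j full_senate_Int_representatives mem by auto
    let ?V = "insert j (T - {i})"
    have VF: "card (?V \<inter> full_senate) = 51"
      using F i j mem by (simp add: card_insert_Int card_remove_Int)
    have VR: "card (?V \<inter> representatives) = card (T \<inter> representatives)"
      using iP jP by (simp add: card_insert_Int card_remove_Int)
    have VS: "card (?V \<inter> senators) \<le> 51"
      using card_Int_senators_le[of ?V] VF by simp
    have "critical President ?V"
      using VF VR VS R mem iP
      by (auto simp: critical_def winning_iff card_remove_Int)
    moreover have "?V \<notin> to_president i ` {U. critical i U}"
    proof
      assume "?V \<in> to_president i ` {U. critical i U}"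
      then obtain W where W: "critical i W" "?V = to_president i W" by blast
      \<comment> \<open>Since \<open>i\<close> was lost, \<open>W\<close> lacks the president and
        wins by (II). That would leave at least 66 senators in \<open>?V\<close>, which has at most
        51.\<close>
      have "i \<in> W" "i \<notin> ?V" using W(1) jP by (auto simp: critical_def)
      then have "President \<notin> W" and V: "?V = insert President (W - {i})"
        using W(2) by (auto simp: to_president_def split: if_splits)
      then have "67 \<le> card (W \<inter> senators)"
        using W(1) by (auto simp: critical_def winning_iff)
      moreover have "card (?V \<inter> senators) \<ge> card (W \<inter> senators) - 1"
        unfolding V by (simp add: card_insert_Int card_remove_Int)
      ultimately show False using VS by linarith
    qed
    ultimately show ?thesis
      using card_exchange[OF mem(2) j(2)] by blast
  next
    case False
    then have TU: "T = insert President (U - {i})" and "i \<in> U"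
      using U by (auto simp: to_president_def critical_def)
    \<comment> \<open>\<open>U\<close> can win only by (II), and \<open>i\<close> is no
      representative, so its removal must break a tight quota of senators. This rules out the vice
      president.\<close>
    have US: "card (U \<inter> senators) = 67" "i \<in> senators" and UR: "290 \<le> card (U \<inter> representatives)"
      using U(1) False iP
      by (auto simp: critical_def winning_iff card_remove_Int split: if_splits)
    have S: "card (T \<inter> senators) = 66" and R: "290 \<le> card (T \<inter> representatives)"
      unfolding TU using US UR iP \<open>i \<in> U\<close> by (auto simp: card_insert_Int card_remove_Int)
    have "i \<notin> T" using TU iP by simp
    have "T \<inter> senators \<noteq> {}" using S by (metis card.empty zero_neq_numeral)
    then obtain j where j: "j \<in> T" "j \<in> senators" by blast
    have jP: "j \<noteq> President" "j \<notin> representatives" "j \<noteq> i"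
      using j \<open>i \<notin> T\<close> senators_subset_full_senate full_senate_Int_representatives by auto
    let ?V = "insert i (T - {j})"
    have VS: "card (?V \<inter> senators) = 66"
      using S US j \<open>i \<notin> T\<close> by (simp add: card_insert_Int card_remove_Int)
    have VR: "card (?V \<inter> representatives) = card (T \<inter> representatives)"
      using iP jP by (simp add: card_insert_Int card_remove_Int)
    have VF: "66 \<le> card (?V \<inter> full_senate)"
      using card_Int_senators_le[of ?V] VS by simp
    have PV: "President \<in> ?V" using TU jP by simp
    have "critical President ?V"
      unfolding critical_def winning_iff card_remove_Int[of ?V] using VF VR VS R PV by auto
    \<comment> \<open>Even without \<open>i\<close>, the president and at least 65 members of the
      full Senate remain, enough for (I).\<close>
    moreover have not_crit: "\<not> critical i ?V"
      unfolding critical_def winning_iff card_remove_Int[of ?V] using VF VR VS R PV iP by auto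
    \<comment> \<open>A replacement would have removed \<open>i\<close>, yet \<open>i\<close> lies
      in \<open>?V\<close>; so the only possible preimage is \<open>?V\<close> itself.\<close>
    have "W = ?V" if "?V = to_president i W" for W
    proof (rule ccontr)
      assume "W \<noteq> ?V"
      with that have "?V = insert President (W - {i})"
        by (metis to_president_def)
      with iP show False by blast
    qed
    then have "?V \<notin> to_president i ` {U. critical i U}"
      using not_crit by blast
    ultimately show ?thesis
      using card_exchange[OF j(1) \<open>i \<notin> T\<close>] by blast
  qed
qed

lemma critical_count_less_president:
  assumes "i \<in> full_senate" and "critical_count President k \<noteq> 0"
  shows "critical_count i k < critical_count President k"
proof -
  obtain T where "card T = k" "critical President T"
    using assms(2) unfolding critical_count_def by (metis (mono_tags, lifting) card.empty
        Collect_empty_eq)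
  then obtain U where "card U = k" "critical President U" "U \<notin> to_president i ` {U. critical i U}"
    using exists_outside_image[OF assms(1)] by metis
  then have "to_president i ` {T. card T = k \<and> critical i T} \<subset> {T. card T = k \<and> critical President T}"
    using to_president_image_subset by blast
  then show ?thesis
    unfolding critical_count_def
    by (metis card_image finite inj_on_to_president_critical psubset_card_mono)
qed

theorem proposition5:
  fixes s :: 100 and r :: 435
  shows "(\<forall>k::nat. c_p k = 0 \<longrightarrow> c_v k = 0 \<and> c_r r k = 0 \<and> c_s s k = 0)
    \<and> (\<forall>k::nat. c_p k \<noteq> 0 \<longrightarrow> c_p k > c_v k)
    \<and> (\<forall>k::nat. c_p k \<noteq> 0 \<longrightarrow> c_p k > c_s s k)"
proof (intro conjI allI impI)
  fix k :: nat
  \<comment> \<open>The weak inequality suffices here, and it covers representatives too.\<close>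
  show "c_v k = 0" "c_r r k = 0" "c_s s k = 0" if "c_p k = 0"
    using that critical_count_le_president[of _ k] by (metis le_zero_eq)+
  show "c_v k < c_p k" "c_s s k < c_p k" if "c_p k \<noteq> 0"
    using that by (simp_all add: critical_count_less_president)
qed

end
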